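(* Let $1\le p\le\infty$. Let $f:\mathbb{R}\to\mathbb{R}$ be in $L^p$ and supported on $I$, where $I$ is a closed bounded interval. Let $\epsilon>0$ and let $\Phi:J\to I$ be an $\epsilon$-deformation with $\Phi'(x)>0$ for all $x\in J$. Let $f_\Phi(x)=f(\Phi(x))\Phi'(x)$ on $J$, and $f_\Phi(x)=0$ elsewhere. Then $$\|f-f_\Phi\|_{V^p}\le\min\left\{\epsilon\cdot K_{p,\Phi}(f),\ \epsilon^{1/p}\cdot\|f\|_{L^1}\right\},$$ where $$K_{p,\Phi}(f)=\min\{\|f\|_{L^p},\|f_\Phi\|_{L^p}\}.$$
   Context: For $p=\infty$, $1/p=0$. $J$ is a closed bounded interval, and an $\epsilon$-deformation $\Phi:J\to I$ is a $C^1$ bijection of $J$ onto $I$ with nowhere-vanishing derivative and $|x-\Phi(x)|\le\epsilon$ for all $x\in J$. Volterra $p$-norm: for an integrable function $h$ supported in $[a,b]$, $(\mathcal{V}h)(x)=\int_a^xh(t)\,dt$ and $\|h\|_{V^p}=\|\mathcal{V}h\|_{L^p([a,b])}$. Here $[a,b]$ is any bounded interval containing $I\cup J$ (since $f-f_\Phi$ has integral $0$, the value does not depend on the choice). *)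

theory Defs
  imports "HOL-Probability.Essential_Supremum"
begin

text \<open>
  The \<open>L\<^sup>p\<close> norm, \<open>1 \<le> p \<le> \<infinity>\<close>, with values in \<^typ>\<open>ennreal\<close>, so that it is \<open>\<infinity>\<close> for a measurable
  function outside \<open>L\<^sup>p\<close>. There is no power with real exponent on \<^typ>\<open>ennreal\<close>, hence the case
  distinction on the integral.
\<close>

definition Lp_norm :: "ennreal \<Rightarrow> 'a measure \<Rightarrow> ('a \<Rightarrow> real) \<Rightarrow> ennreal" where
  "Lp_norm p M f =
    (if p = \<infinity> then esssup M (\<lambda>x. ennreal \<bar>f x\<bar>)
     else let N = \<integral>\<^sup>+ x. ennreal (\<bar>f x\<bar> powr enn2real p) \<partial>M
          in if N = \<infinity> then \<infinity> else ennreal (enn2real N powr (1 / enn2real p)))"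

definition in_Lp :: "ennreal \<Rightarrow> 'a measure \<Rightarrow> ('a \<Rightarrow> real) \<Rightarrow> bool" where
  "in_Lp p M f \<longleftrightarrow> f \<in> borel_measurable M \<and> Lp_norm p M f < \<infinity>"

definition volterra :: "real \<Rightarrow> (real \<Rightarrow> real) \<Rightarrow> real \<Rightarrow> real" where
  "volterra a h x = (LINT t:{a..x}|lebesgue. h t)"

definition volterra_norm :: "ennreal \<Rightarrow> real \<Rightarrow> real \<Rightarrow> (real \<Rightarrow> real) \<Rightarrow> ennreal" where
  "volterra_norm p a b h = Lp_norm p (lebesgue_on {a..b}) (volterra a h)"

text \<open>
  \<open>\<Phi>'\<close> is the derivative of \<open>\<Phi>\<close> on \<open>J\<close>, one-sided at the endpoints; it is uniquely determined on \<open>J\<close>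
  by \<open>\<Phi>\<close> unless \<open>J\<close> is a single point. Values of \<open>\<Phi>\<close> and \<open>\<Phi>'\<close> outside \<open>J\<close> are irrelevant.
\<close>

definition eps_deformation ::
    "real \<Rightarrow> real set \<Rightarrow> real set \<Rightarrow> (real \<Rightarrow> real) \<Rightarrow> (real \<Rightarrow> real) \<Rightarrow> bool" where
  "eps_deformation \<epsilon> J I \<Phi> \<Phi>' \<longleftrightarrow>
     bij_betw \<Phi> J I \<and>
     (\<forall>x\<in>J. (\<Phi> has_real_derivative \<Phi>' x) (at x within J)) \<and>
     continuous_on J \<Phi>' \<and>
     (\<forall>x\<in>J. \<Phi>' x \<noteq> 0) \<and>
     (\<forall>x\<in>J. \<bar>x - \<Phi> x\<bar> \<le> \<epsilon>)"

definition deformed ::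
    "real set \<Rightarrow> (real \<Rightarrow> real) \<Rightarrow> (real \<Rightarrow> real) \<Rightarrow> (real \<Rightarrow> real) \<Rightarrow> real \<Rightarrow> real" where
  "deformed J \<Phi> \<Phi>' f x = (if x \<in> J then f (\<Phi> x) * \<Phi>' x else 0)"

definition K_deform ::
    "ennreal \<Rightarrow> real set \<Rightarrow> (real \<Rightarrow> real) \<Rightarrow> (real \<Rightarrow> real) \<Rightarrow> (real \<Rightarrow> real) \<Rightarrow> ennreal" where
  "K_deform p J \<Phi> \<Phi>' f =
     min (Lp_norm p lebesgue f) (Lp_norm p lebesgue (deformed J \<Phi> \<Phi>' f))"

end

theory Submission
  imports Defs
begin

text \<open>
  Write \<open>F\<close> for the primitive of \<open>f\<close> that vanishes at \<open>-\<infinity>\<close>. The substitution rule says that the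
  primitive \<open>G\<close> of the deformed function is \<open>F \<circ> \<Phi>\<close> on \<open>J\<close>. Beyond the endpoints of \<open>J\<close> extend \<open>\<Phi>\<close>
  by translations to a strictly increasing bijection \<open>\<Psi>\<close> of the line
  (\<open>strict_mono_on_extend_by_translations\<close>). The extension still moves no point by more than \<open>\<epsilon>\<close>,
  and since \<open>f\<close> vanishes outside \<open>I\<close> it gives \<open>G = F \<circ> \<Psi>\<close> everywhere (\<open>primitive_deformed\<close>).
  Hence the Volterra transform of the difference is
  \<open>h x = F x - F (\<Psi> x)\<close>, and \<open>\<bar>h x\<bar>\<close> is at most the integral of \<open>\<bar>f\<bar>\<close> over the segment between
  \<open>x\<close> and \<open>\<Psi> x\<close>.

  So \<open>h\<close> is dominated by an integral operator whose kernel is the indicator of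
  \<open>A = {(x, t). t lies between x and \<Psi> x}\<close>. For fixed \<open>x\<close> the section of \<open>A\<close> is a segment of length
  at most \<open>\<epsilon>\<close>. For fixed \<open>t\<close> it is contained in the segment between \<open>t\<close> and \<open>\<Psi>\<^sup>-\<^sup>1 t\<close>, because \<open>\<Psi>\<close>
  is increasing, and that segment has length at most \<open>\<epsilon>\<close> too. Schur's test
  (\<open>Schur_test_indicator\<close>) then bounds \<open>h\<close> in \<open>L\<^sup>p\<close> by \<open>\<epsilon>\<close> times the \<open>L\<^sup>p\<close> norm of \<open>f\<close>; and
  interpolating between \<open>p = 1\<close> and the trivial bound of \<open>\<bar>h\<bar>\<close> by the \<open>L\<^sup>1\<close> norm of \<open>f\<close> gives the
  estimate with \<open>\<epsilon>\<close> to the power \<open>1 / p\<close>.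

  The bound by the norm of the deformed function needs no new argument: up to sign, \<open>h\<close> at \<open>x\<close> is
  \<open>G x - G (\<Psi>\<^sup>-\<^sup>1 x)\<close>, so it is the same estimate (\<open>Lp_norm_primitive_displacement_le\<close>) for the
  deformed function and the inverse displacement.
\<close>

section \<open>Norms in \<open>L\<^sup>p\<close>\<close>

text \<open>
  Comparing \<open>p\<close>-th powers keeps all estimates below free of roots and of the case of an infinite
  integral.
\<close>

lemma Lp_norm_le_iff_nn_integral:
  assumes "1 \<le> p" "p \<noteq> \<infinity>" "0 \<le> C"
  shows "Lp_norm p M f \<le> ennreal C \<longleftrightarrow>
    (\<integral>\<^sup>+ x. ennreal (\<bar>f x\<bar> powr enn2real p) \<partial>M) \<le> ennreal (C powr enn2real p)"
proof -
  obtain r where r: "p = ennreal r" "r \<ge> 1"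
    using assms by (cases p) (auto simp: ennreal_ge_1)
  then have er: "enn2real p = r" by simp
  define N where "N = (\<integral>\<^sup>+ x. ennreal (\<bar>f x\<bar> powr r) \<partial>M)"
  have eq: "n powr (1 / r) \<le> C \<longleftrightarrow> n \<le> C powr r" if "n \<ge> 0" for n
  proof
    assume "n powr (1 / r) \<le> C"
    then have "(n powr (1 / r)) powr r \<le> C powr r"
      using r by (intro powr_mono2) auto
    then show "n \<le> C powr r" using r that by (simp add: powr_powr)
  next
    assume "n \<le> C powr r"
    then have "n powr (1 / r) \<le> (C powr r) powr (1 / r)"
      using r that by (intro powr_mono2) auto
    then show "n powr (1 / r) \<le> C" using r assms(3) by (simp add: powr_powr)
  qed
  show ?thesis
  proof (cases N)
    case (real n)
    then show ?thesis
      using eq[of n] assms r unfolding Lp_norm_def er N_def[symmetric]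
      by (simp add: Let_def)
  next
    case top
    then show ?thesis
      using assms unfolding Lp_norm_def er N_def[symmetric] by (simp add: Let_def top_unique)
  qed
qed

lemma AE_abs_le_Lp_norm_infinity: "AE x in M. ennreal \<bar>f x\<bar> \<le> Lp_norm \<infinity> M f"
  using esssup_AE[of "\<lambda>x. ennreal \<bar>f x\<bar>" M] by (simp add: Lp_norm_def)

lemma Lp_norm_infinity_le:
  assumes "f \<in> borel_measurable M" "AE x in M. ennreal \<bar>f x\<bar> \<le> C"
  shows "Lp_norm \<infinity> M f \<le> C"
  using assms by (auto simp: Lp_norm_def intro!: esssup_I)

lemma Lp_norm_1: "Lp_norm 1 M f = (\<integral>\<^sup>+ x. ennreal \<bar>f x\<bar> \<partial>M)"
proof (cases "(\<integral>\<^sup>+ x. ennreal \<bar>f x\<bar> \<partial>M)")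
qed (auto simp: Lp_norm_def Let_def)

lemma Lp_norm_restrict_space_le:
  assumes S: "S \<inter> space M \<in> sets M" and f: "f \<in> borel_measurable M" and p: "1 \<le> p"
  shows "Lp_norm p (restrict_space M S) f \<le> Lp_norm p M f"
proof (cases "p = \<infinity>")
  case True
  have "Lp_norm \<infinity> (restrict_space M S) f \<le> Lp_norm \<infinity> M f"
    using S f AE_abs_le_Lp_norm_infinity[of f M]
    by (intro Lp_norm_infinity_le)
       (auto simp: AE_restrict_space_iff intro: measurable_restrict_space1)
  then show ?thesis using True by simp
next
  case False
  show ?thesis
  proof (cases "Lp_norm p M f")
    case (real C)
    have "(\<integral>\<^sup>+ x. ennreal (\<bar>f x\<bar> powr enn2real p) \<partial>restrict_space M S)
        \<le> (\<integral>\<^sup>+ x. ennreal (\<bar>f x\<bar> powr enn2real p) \<partial>M)"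
      by (subst nn_integral_restrict_space[OF S]) (auto intro!: nn_integral_mono simp: indicator_def)
    also have "\<dots> \<le> ennreal (C powr enn2real p)"
      using Lp_norm_le_iff_nn_integral[OF p False] real by (metis order_refl)
    finally show ?thesis
      using Lp_norm_le_iff_nn_integral[OF p False] real by metis
  qed simp
qed

lemma Lp_norm_minus_commute:
  "Lp_norm p M (\<lambda>x. f x - g x) = Lp_norm p M (\<lambda>x. g x - f x)"
  by (simp add: Lp_norm_def abs_minus_commute)

text \<open>
  For finite \<open>p\<close> this is \<open>\<bar>f\<bar> \<le> \<bar>f\<bar>\<^sup>p + 1\<close> on \<open>S\<close>; for \<open>p = \<infinity>\<close> the function is essentially bounded.
\<close>

lemma in_Lp_finite_support_integrable:
  assumes p: "1 \<le> p" and f: "in_Lp p M f"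
    and S [measurable]: "S \<in> sets M" and fin: "emeasure M S < \<infinity>"
    and supp: "\<And>x. x \<notin> S \<Longrightarrow> f x = 0"
  shows "integrable M f"
proof (rule integrableI_bounded)
  show [measurable]: "f \<in> borel_measurable M" using f by (simp add: in_Lp_def)
  obtain C where C: "C \<ge> 0" "Lp_norm p M f = ennreal C"
    using f by (cases "Lp_norm p M f") (auto simp: in_Lp_def)
  show "(\<integral>\<^sup>+ x. ennreal (norm (f x)) \<partial>M) < \<infinity>"
  proof (cases "p = \<infinity>")
    case True
    have "(\<integral>\<^sup>+ x. ennreal (norm (f x)) \<partial>M) \<le> (\<integral>\<^sup>+ x. ennreal C * indicator S x \<partial>M)"
      using AE_abs_le_Lp_norm_infinity[of f M] C True
      by (intro nn_integral_mono_AE) (auto elim!: eventually_mono simp: indicator_def supp)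
    also have "\<dots> = ennreal C * emeasure M S"
      by (rule nn_integral_cmult_indicator) measurable
    also have "\<dots> < \<infinity>" using fin by (simp add: ennreal_mult_less_top)
    finally show ?thesis .
  next
    case False
    define r where "r = enn2real p"
    have r: "r \<ge> 1" using False p by (cases p) (auto simp: ennreal_ge_1 r_def)
    have "(\<integral>\<^sup>+ x. ennreal (norm (f x)) \<partial>M)
        \<le> (\<integral>\<^sup>+ x. ennreal (\<bar>f x\<bar> powr r) + indicator S x \<partial>M)"
    proof (rule nn_integral_mono)
      fix x
      have "\<bar>f x\<bar> \<le> \<bar>f x\<bar> powr r + 1"
        using r powr_mono[of 1 r "\<bar>f x\<bar>"] powr_ge_zero[of "\<bar>f x\<bar>" r]
        by (cases "\<bar>f x\<bar> \<le> 1") (linarith, simp)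
      then have "ennreal \<bar>f x\<bar> \<le> ennreal (\<bar>f x\<bar> powr r) + 1"
        by (simp flip: ennreal_plus ennreal_1)
      then show "ennreal (norm (f x)) \<le> ennreal (\<bar>f x\<bar> powr r) + indicator S x"
        using supp[of x] by (auto simp: indicator_def)
    qed
    also have "\<dots> = (\<integral>\<^sup>+ x. ennreal (\<bar>f x\<bar> powr r) \<partial>M) + emeasure M S"
      by (subst nn_integral_add) auto
    also have "\<dots> \<le> ennreal (C powr r) + emeasure M S"
      using Lp_norm_le_iff_nn_integral[OF p False C(1), of M f] C
      by (intro add_right_mono) (simp add: r_def)
    also have "\<dots> < \<infinity>" using fin by simp
    finally show ?thesis .
  qed
qed

section \<open>Schur's test for the indicator of a set with small sections\<close>

text \<open>
  The graph of \<open>u \<mapsto> u\<^sup>r\<close> lies above its tangent at \<open>m\<close>; as an inequality between products this is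
  Young's inequality for \<open>u\<close> and \<open>m\<^sup>r\<^sup>-\<^sup>1\<close>.
\<close>

lemma powr_tangent_le:
  fixes u m r :: real
  assumes "u \<ge> 0" "m \<ge> 0" "r \<ge> 1"
  shows "r * m powr (r - 1) * u \<le> u powr r + (r - 1) * m powr r"
proof (cases "r = 1")
  case True
  then show ?thesis using assms by simp
next
  case False
  then have r: "r > 1" using assms by simp
  have "u * m powr (r - 1) \<le> u powr r / r + (m powr (r - 1)) powr (r / (r - 1)) / (r / (r - 1))"
    using r assms by (intro Youngs_inequality) (auto simp: field_simps)
  also have "(m powr (r - 1)) powr (r / (r - 1)) = m powr r"
    using r by (simp add: powr_powr)
  finally show ?thesis using r by (simp add: field_simps)
qed

text \<open>
  This is Jensen's inequality with the measure of \<open>S\<close> replaced by an upper bound \<open>\<epsilon>\<close>. If \<open>\<epsilon>\<close> were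
  the measure of \<open>S\<close>, then \<open>y / \<epsilon>\<close> would be a lower bound for the mean of \<open>\<bar>f\<bar>\<close>, and integrating the
  tangent inequality at that value would be the usual proof. An \<open>\<epsilon>\<close> that is too large does no
  harm, since the measure of \<open>S\<close> occurs only in the term \<open>(r - 1) m\<^sup>r\<close>, on the larger side.
\<close>

lemma powr_nn_integral_le:
  fixes f :: "'a \<Rightarrow> real"
  assumes [measurable]: "f \<in> borel_measurable M" "S \<in> sets M"
    and S: "emeasure M S \<le> ennreal \<epsilon>" and "\<epsilon> > 0" and r: "r \<ge> 1" and "y \<ge> 0"
    and y: "ennreal y \<le> (\<integral>\<^sup>+ t. ennreal \<bar>f t\<bar> * indicator S t \<partial>M)"
  shows "ennreal (y powr r)
    \<le> ennreal (\<epsilon> powr (r - 1)) * (\<integral>\<^sup>+ t. ennreal (\<bar>f t\<bar> powr r) * indicator S t \<partial>M)"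
proof -
  define m where "m = y / \<epsilon>"
  have m: "m \<ge> 0" "y = \<epsilon> * m" using assms by (auto simp: m_def)
  let ?I = "\<integral>\<^sup>+ t. ennreal (\<bar>f t\<bar> powr r) * indicator S t \<partial>M"
  define k where "k = m powr r * \<epsilon>"
  have k: "k \<ge> 0" using assms by (simp add: k_def)
  \<comment> \<open>The case \<open>m = 0\<close> is separate because \<open>0 powr 0 = 0\<close>.\<close>
  have km: "m powr (r - 1) * y = k"
    using r m by (cases "m = 0") (auto simp: k_def powr_diff)
  have "ennreal (r * k) = ennreal (r * m powr (r - 1)) * ennreal y"
    using r km m \<open>y \<ge> 0\<close> by (subst ennreal_mult[symmetric]) (auto simp: mult.assoc)
  also have "\<dots> \<le> ennreal (r * m powr (r - 1)) * (\<integral>\<^sup>+ t. ennreal \<bar>f t\<bar> * indicator S t \<partial>M)"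
    by (intro mult_left_mono y) auto
  also have "\<dots> = (\<integral>\<^sup>+ t. ennreal (r * m powr (r - 1)) * (ennreal \<bar>f t\<bar> * indicator S t) \<partial>M)"
    by (subst nn_integral_cmult) auto
  also have "\<dots> \<le> (\<integral>\<^sup>+ t. ennreal (\<bar>f t\<bar> powr r) * indicator S t
                       + ennreal ((r - 1) * m powr r) * indicator S t \<partial>M)"
  proof (rule nn_integral_mono)
    fix t
    have "ennreal (r * m powr (r - 1)) * ennreal \<bar>f t\<bar>
        \<le> ennreal (\<bar>f t\<bar> powr r) + ennreal ((r - 1) * m powr r)"
      using powr_tangent_le[of "\<bar>f t\<bar>" m r] r m
      by (simp flip: ennreal_mult ennreal_plus)
    then show "ennreal (r * m powr (r - 1)) * (ennreal \<bar>f t\<bar> * indicator S t)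
        \<le> ennreal (\<bar>f t\<bar> powr r) * indicator S t + ennreal ((r - 1) * m powr r) * indicator S t"
      by (auto simp: indicator_def)
  qed
  also have "\<dots> = ?I + ennreal ((r - 1) * m powr r) * emeasure M S"
    by (subst nn_integral_add) (auto simp: nn_integral_cmult_indicator)
  also have "\<dots> \<le> ?I + ennreal ((r - 1) * m powr r) * ennreal \<epsilon>"
    by (intro add_left_mono mult_left_mono S) auto
  also have "\<dots> = ?I + ennreal ((r - 1) * k)"
    using r \<open>\<epsilon> > 0\<close> by (subst ennreal_mult[symmetric]) (auto simp: k_def mult_ac)
  finally have le: "ennreal (r * k) \<le> ?I + ennreal ((r - 1) * k)" .
  have "ennreal (r * k) = ennreal k + ennreal ((r - 1) * k)"
    using r k mult_left_mono[of 1 r k] by (subst ennreal_plus[symmetric]) (auto simp: algebra_simps)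
  then have "ennreal k + ennreal ((r - 1) * k) \<le> ?I + ennreal ((r - 1) * k)"
    using le by simp
  then have "ennreal k \<le> ?I"
    by (simp add: ennreal_add_left_cancel_le add.commute)
  then have "ennreal (\<epsilon> powr (r - 1)) * ennreal k \<le> ennreal (\<epsilon> powr (r - 1)) * ?I"
    by (intro mult_left_mono) auto
  moreover have "\<epsilon> powr (r - 1) * k = y powr r"
    using m \<open>\<epsilon> > 0\<close> by (simp add: k_def powr_mult powr_diff)
  ultimately show ?thesis
    using k by (simp flip: ennreal_mult)
qed

lemma (in pair_sigma_finite) nn_integral_sections_le:
  fixes h :: "'b \<Rightarrow> ennreal"
  assumes [measurable]: "A \<in> sets (M1 \<Otimes>\<^sub>M M2)" "h \<in> borel_measurable M2"
    and A: "\<And>t. t \<in> space M2 \<Longrightarrow> emeasure M1 {x \<in> space M1. (x, t) \<in> A} \<le> e"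
  shows "(\<integral>\<^sup>+ x. (\<integral>\<^sup>+ t. h t * indicator {t \<in> space M2. (x, t) \<in> A} t \<partial>M2) \<partial>M1) \<le> e * (\<integral>\<^sup>+ t. h t \<partial>M2)"
proof -
  have "(\<integral>\<^sup>+ x. (\<integral>\<^sup>+ t. h t * indicator {t \<in> space M2. (x, t) \<in> A} t \<partial>M2) \<partial>M1)
      = (\<integral>\<^sup>+ x. (\<integral>\<^sup>+ t. h t * indicator A (x, t) \<partial>M2) \<partial>M1)"
    by (intro nn_integral_cong) (auto simp: indicator_def)
  also have "\<dots> = (\<integral>\<^sup>+ t. (\<integral>\<^sup>+ x. h t * indicator A (x, t) \<partial>M1) \<partial>M2)"
    by (rule Fubini'[symmetric]) measurable
  also have "\<dots> \<le> (\<integral>\<^sup>+ t. e * h t \<partial>M2)"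
  proof (rule nn_integral_mono)
    fix t assume t [measurable]: "t \<in> space M2"
    have "(\<integral>\<^sup>+ x. h t * indicator A (x, t) \<partial>M1) = (\<integral>\<^sup>+ x. h t * indicator {x \<in> space M1. (x, t) \<in> A} x \<partial>M1)"
      by (intro nn_integral_cong) (auto simp: indicator_def)
    also have "\<dots> = h t * emeasure M1 {x \<in> space M1. (x, t) \<in> A}"
      by (rule nn_integral_cmult_indicator) measurable
    also have "\<dots> \<le> e * h t"
      using mult_right_mono[OF A[OF t], of "h t"] by (simp add: mult.commute)
    finally show "(\<integral>\<^sup>+ x. h t * indicator A (x, t) \<partial>M1) \<le> e * h t" .
  qed
  also have "\<dots> = e * (\<integral>\<^sup>+ t. h t \<partial>M2)"
    by (rule nn_integral_cmult) measurable
  finally show ?thesis .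
qed

text \<open>
  Let \<open>p = r\<close> be finite; for \<open>p = \<infinity>\<close> both bounds are pointwise.
  Jensen's inequality on the section \<open>A\<^sub>x\<close> bounds \<open>\<bar>g x\<bar>\<^sup>r\<close> by \<open>\<epsilon>\<^sup>r\<^sup>-\<^sup>1\<close> times the integral of \<open>\<bar>f\<bar>\<^sup>r\<close>
  over \<open>A\<^sub>x\<close>; integrating over \<open>x\<close> and exchanging the integrals contributes the last factor \<open>\<epsilon>\<close>, from
  the other family of sections. For the second bound let \<open>C\<close> be the \<open>L\<^sup>1\<close> norm of \<open>f\<close>. Then
  \<open>\<bar>g\<bar>\<^sup>r \<le> C\<^sup>r\<^sup>-\<^sup>1 \<bar>g\<bar>\<close>, and the integral of \<open>\<bar>g\<bar>\<close> is at most \<open>\<epsilon> C\<close>.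
\<close>

lemma (in pair_sigma_finite) Schur_test_indicator:
  fixes f :: "'b \<Rightarrow> real" and g :: "'a \<Rightarrow> real"
  assumes [measurable]: "A \<in> sets (M1 \<Otimes>\<^sub>M M2)" "f \<in> borel_measurable M2" "g \<in> borel_measurable M1"
    and "\<epsilon> > 0" and p: "1 \<le> p"
    and A1: "\<And>t. t \<in> space M2 \<Longrightarrow> emeasure M1 {x \<in> space M1. (x, t) \<in> A} \<le> ennreal \<epsilon>"
    and A2: "\<And>x. x \<in> space M1 \<Longrightarrow> emeasure M2 {t \<in> space M2. (x, t) \<in> A} \<le> ennreal \<epsilon>"
    and g: "\<And>x. x \<in> space M1 \<Longrightarrow>
      ennreal \<bar>g x\<bar> \<le> (\<integral>\<^sup>+ t. ennreal \<bar>f t\<bar> * indicator {t \<in> space M2. (x, t) \<in> A} t \<partial>M2)"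
  shows "Lp_norm p M1 g \<le> ennreal \<epsilon> * Lp_norm p M2 f" (is ?Lp)
    and "Lp_norm p M1 g \<le> ennreal (\<epsilon> powr enn2real (1 / p)) * Lp_norm 1 M2 f" (is ?L1)
proof -
  have g_le: "ennreal \<bar>g x\<bar> \<le> (\<integral>\<^sup>+ t. ennreal \<bar>f t\<bar> \<partial>M2)" if "x \<in> space M1" for x
    using g[OF that] by (rule order_trans) (auto intro!: nn_integral_mono simp: indicator_def)
  have "?Lp \<and> ?L1"
  proof (cases "p = \<infinity>")
    case True
    have "Lp_norm \<infinity> M1 g \<le> ennreal \<epsilon> * Lp_norm \<infinity> M2 f"
    proof (rule Lp_norm_infinity_le)
      have "ennreal \<bar>g x\<bar> \<le> ennreal \<epsilon> * Lp_norm \<infinity> M2 f" if x [measurable]: "x \<in> space M1" for x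
      proof -
        have "ennreal \<bar>g x\<bar> \<le> (\<integral>\<^sup>+ t. ennreal \<bar>f t\<bar> * indicator {t \<in> space M2. (x, t) \<in> A} t \<partial>M2)"
          by (rule g[OF x])
        also have "\<dots> \<le> (\<integral>\<^sup>+ t. Lp_norm \<infinity> M2 f * indicator {t \<in> space M2. (x, t) \<in> A} t \<partial>M2)"
          using AE_abs_le_Lp_norm_infinity[of f M2]
          by (intro nn_integral_mono_AE) (auto intro!: mult_right_mono)
        also have "\<dots> = Lp_norm \<infinity> M2 f * emeasure M2 {t \<in> space M2. (x, t) \<in> A}"
          by (rule nn_integral_cmult_indicator) measurable
        also have "\<dots> \<le> ennreal \<epsilon> * Lp_norm \<infinity> M2 f"
          using mult_right_mono[OF A2[OF x], of "Lp_norm \<infinity> M2 f"] by (simp add: mult.commute)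
        finally show ?thesis .
      qed
      then show "AE x in M1. ennreal \<bar>g x\<bar> \<le> ennreal \<epsilon> * Lp_norm \<infinity> M2 f" by simp
    qed measurable
    moreover have "Lp_norm \<infinity> M1 g \<le> Lp_norm 1 M2 f"
      by (rule Lp_norm_infinity_le) (auto simp: Lp_norm_1 g_le)
    ultimately show ?thesis
      using True \<open>\<epsilon> > 0\<close> by simp
  next
    case False
    obtain r where r: "p = ennreal r" "r \<ge> 1"
      using False p by (cases p) (auto simp: ennreal_ge_1)
    then have er: "enn2real p = r" by simp
    have "1 / p = ennreal (1 / r)"
      using r divide_ennreal[of 1 r] by (simp add: divide_ennreal)
    then have inv_p: "enn2real (1 / p) = 1 / r" using r by simp
    note norm_le = Lp_norm_le_iff_nn_integral[OF p False, unfolded er]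
    have ?Lp
    proof (cases "Lp_norm p M2 f")
      case (real C)
      have "(\<integral>\<^sup>+ x. ennreal (\<bar>g x\<bar> powr r) \<partial>M1)
          \<le> (\<integral>\<^sup>+ x. ennreal (\<epsilon> powr (r - 1)) *
               (\<integral>\<^sup>+ t. ennreal (\<bar>f t\<bar> powr r) * indicator {t \<in> space M2. (x, t) \<in> A} t \<partial>M2) \<partial>M1)"
        using r \<open>\<epsilon> > 0\<close> A2 g
        by (intro nn_integral_mono powr_nn_integral_le) auto
      also have "\<dots> = ennreal (\<epsilon> powr (r - 1)) *
          (\<integral>\<^sup>+ x. (\<integral>\<^sup>+ t. ennreal (\<bar>f t\<bar> powr r) * indicator {t \<in> space M2. (x, t) \<in> A} t \<partial>M2) \<partial>M1)"
        by (rule nn_integral_cmult) measurable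
      also have "\<dots> \<le> ennreal (\<epsilon> powr (r - 1)) * (ennreal \<epsilon> * (\<integral>\<^sup>+ t. ennreal (\<bar>f t\<bar> powr r) \<partial>M2))"
        by (intro mult_left_mono nn_integral_sections_le A1) auto
      also have "\<dots> \<le> ennreal (\<epsilon> powr (r - 1)) * (ennreal \<epsilon> * ennreal (C powr r))"
        using norm_le[of C M2 f] real by (intro mult_left_mono) auto
      also have "\<dots> = ennreal ((\<epsilon> * C) powr r)"
        using \<open>\<epsilon> > 0\<close> real by (simp add: powr_mult powr_diff flip: ennreal_mult)
      finally show ?thesis
        using norm_le[of "\<epsilon> * C" M1 g] real \<open>\<epsilon> > 0\<close> by (simp add: ennreal_mult)
    next
      case top
      then show ?thesis using \<open>\<epsilon> > 0\<close> by (simp add: ennreal_mult_top)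
    qed
    moreover have ?L1
    proof (cases "Lp_norm 1 M2 f")
      case (real C)
      then have fC: "(\<integral>\<^sup>+ t. ennreal \<bar>f t\<bar> \<partial>M2) = ennreal C" by (simp add: Lp_norm_1)
      have "(\<integral>\<^sup>+ x. ennreal (\<bar>g x\<bar> powr r) \<partial>M1)
          \<le> (\<integral>\<^sup>+ x. ennreal (C powr (r - 1)) *
               (\<integral>\<^sup>+ t. ennreal \<bar>f t\<bar> * indicator {t \<in> space M2. (x, t) \<in> A} t \<partial>M2) \<partial>M1)"
      proof (rule nn_integral_mono)
        fix x assume x: "x \<in> space M1"
        have "\<bar>g x\<bar> \<le> C" using g_le[OF x] fC real by simp
        then have "\<bar>g x\<bar> powr (r - 1) \<le> C powr (r - 1)"
          using r by (intro powr_mono2) auto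
        then have "\<bar>g x\<bar> powr r \<le> C powr (r - 1) * \<bar>g x\<bar>"
          using mult_right_mono[of "\<bar>g x\<bar> powr (r - 1)" "C powr (r - 1)" "\<bar>g x\<bar>"]
          by (cases "g x = 0") (auto simp: powr_diff)
        then have "ennreal (\<bar>g x\<bar> powr r) \<le> ennreal (C powr (r - 1)) * ennreal \<bar>g x\<bar>"
          by (simp flip: ennreal_mult)
        also have "\<dots> \<le> ennreal (C powr (r - 1)) *
            (\<integral>\<^sup>+ t. ennreal \<bar>f t\<bar> * indicator {t \<in> space M2. (x, t) \<in> A} t \<partial>M2)"
          by (intro mult_left_mono g x) auto
        finally show "ennreal (\<bar>g x\<bar> powr r) \<le> \<dots>" .
      qed
      also have "\<dots> = ennreal (C powr (r - 1)) *
          (\<integral>\<^sup>+ x. (\<integral>\<^sup>+ t. ennreal \<bar>f t\<bar> * indicator {t \<in> space M2. (x, t) \<in> A} t \<partial>M2) \<partial>M1)"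
        by (rule nn_integral_cmult) measurable
      also have "\<dots> \<le> ennreal (C powr (r - 1)) * (ennreal \<epsilon> * ennreal C)"
        unfolding fC[symmetric] by (intro mult_left_mono nn_integral_sections_le A1) auto
      also have "\<dots> = ennreal ((\<epsilon> powr (1 / r) * C) powr r)"
        using \<open>\<epsilon> > 0\<close> real r
        by (cases "C = 0") (auto simp: powr_mult powr_diff powr_powr simp flip: ennreal_mult)
      finally show ?thesis
        using norm_le[of "\<epsilon> powr (1 / r) * C" M1 g] real \<open>\<epsilon> > 0\<close>
        by (simp add: ennreal_mult inv_p)
    next
      case top
      then show ?thesis using \<open>\<epsilon> > 0\<close> by (simp add: ennreal_mult_top inv_p)
    qed
    ultimately show ?thesis by blast
  qed
  then show ?Lp ?L1 by auto
qed

section \<open>Primitives along a displacement of the line\<close>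

text \<open>
  Lebesgue measure is the completion of \<^const>\<open>lborel\<close>, and it must be \<open>\<sigma>\<close>-finite for the integrals
  over the plane to be exchanged.
\<close>

lemma sigma_finite_completion:
  assumes "sigma_finite_measure M"
  shows "sigma_finite_measure (completion M)"
proof -
  obtain A where A: "countable A" "A \<subseteq> sets M" "\<Union>A = space M" "\<forall>a\<in>A. emeasure M a \<noteq> \<infinity>"
    using assms by (auto simp: sigma_finite_measure_def)
  then show ?thesis
    by (intro sigma_finite_measure.intro exI[of _ A]) (auto simp: subset_iff)
qed


text \<open>
  Integrating from \<open>-\<infinity>\<close> instead of from the left end of an interval makes the primitive
  meaningful at points that a translation moves out of the interval.
\<close>

definition primitive :: "(real \<Rightarrow> real) \<Rightarrow> real \<Rightarrow> real" where
  "primitive f x = (LINT t:{..x}|lebesgue. f t)"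

lemma borel_measurable_primitive:
  assumes [measurable]: "f \<in> borel_measurable lebesgue"
  shows "primitive f \<in> borel_measurable borel"
proof -
  have [measurable]: "snd \<in> borel_measurable (borel \<Otimes>\<^sub>M (lebesgue :: real measure))"
    using measurable_compose[OF measurable_snd, of "\<lambda>x. x" lebesgue borel borel]
    by (simp add: measurable_completion)
  have "(\<lambda>x. LINT t|lebesgue. (if t \<le> x then f t else 0)) \<in> borel_measurable borel"
    by (rule sigma_finite_measure.borel_measurable_lebesgue_integral
          [OF sigma_finite_completion[OF sigma_finite_lborel]])
       (simp add: split_beta')
  also have "(\<lambda>x. LINT t|lebesgue. (if t \<le> x then f t else 0)) = primitive f"
    by (auto simp: primitive_def set_lebesgue_integral_def indicator_def fun_eq_iff
        intro!: Bochner_Integration.integral_cong)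
  finally show ?thesis .
qed

lemma abs_primitive_diff_le:
  assumes f: "integrable lebesgue f"
  shows "ennreal \<bar>primitive f x - primitive f y\<bar>
    \<le> (\<integral>\<^sup>+ t. ennreal \<bar>f t\<bar> * indicator {min x y..max x y} t \<partial>lebesgue)"
proof -
  have int: "integrable lebesgue (\<lambda>t. indicator {..z} t *\<^sub>R f t)" for z :: real
    using f by (intro integrable_mult_indicator) auto
  have "primitive f x - primitive f y
      = (LINT t|lebesgue. indicator {..x} t *\<^sub>R f t - indicator {..y} t *\<^sub>R f t)"
    unfolding primitive_def set_lebesgue_integral_def
    by (rule Bochner_Integration.integral_diff[symmetric]) (rule int)+
  then have "ennreal \<bar>primitive f x - primitive f y\<bar>
      \<le> (\<integral>\<^sup>+ t. ennreal (norm (indicator {..x} t *\<^sub>R f t - indicator {..y} t *\<^sub>R f t)) \<partial>lebesgue)"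
    using integral_norm_bound_ennreal[OF Bochner_Integration.integrable_diff[OF int[of x] int[of y]]]
    by simp
  also have "\<dots> \<le> (\<integral>\<^sup>+ t. ennreal \<bar>f t\<bar> * indicator {min x y..max x y} t \<partial>lebesgue)"
    by (intro nn_integral_mono) (auto simp: indicator_def)
  finally show ?thesis .
qed

text \<open>
  The hypotheses are symmetric in \<open>\<Psi>\<close> and its inverse, so that the result can be used for both.
\<close>

lemma Lp_norm_primitive_displacement_le:
  fixes f \<Psi> :: "real \<Rightarrow> real"
  assumes f: "integrable lebesgue f" and mono: "strict_mono \<Psi>" and "surj \<Psi>"
    and disp: "\<And>x. \<bar>x - \<Psi> x\<bar> \<le> \<epsilon>" and "\<epsilon> > 0" and p: "1 \<le> p"
  shows "(\<lambda>x. primitive f x - primitive f (\<Psi> x)) \<in> borel_measurable lebesgue"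
    and "Lp_norm p lebesgue (\<lambda>x. primitive f x - primitive f (\<Psi> x))
      \<le> ennreal \<epsilon> * Lp_norm p lebesgue f"
    and "Lp_norm p lebesgue (\<lambda>x. primitive f x - primitive f (\<Psi> x))
      \<le> ennreal (\<epsilon> powr enn2real (1 / p)) * Lp_norm 1 lebesgue f"
proof -
  have [measurable]: "f \<in> borel_measurable lebesgue" using f by simp
  have [measurable]: "\<Psi> \<in> borel_measurable borel"
    using mono by (intro borel_measurable_mono strict_mono_mono)
  have [measurable]: "primitive f \<in> borel_measurable borel"
    by (rule borel_measurable_primitive) measurable
  have "(\<lambda>x. primitive f x - primitive f (\<Psi> x)) \<in> borel_measurable borel" by measurable
  then show meas: "(\<lambda>x. primitive f x - primitive f (\<Psi> x)) \<in> borel_measurable lebesgue"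
    by (simp add: measurable_completion)

  interpret pair_sigma_finite "lebesgue :: real measure" "lebesgue :: real measure"
    by (intro pair_sigma_finite.intro sigma_finite_completion sigma_finite_lborel)
  define A where "A = {z. min (fst z) (\<Psi> (fst z)) \<le> snd z \<and> snd z \<le> max (fst z) (\<Psi> (fst z))}"
  have sec: "{t \<in> space lebesgue. (x, t) \<in> A} = {min x (\<Psi> x)..max x (\<Psi> x)}" for x
    by (auto simp: A_def)
  have A: "A \<in> sets (lebesgue \<Otimes>\<^sub>M lebesgue)"
  proof -
    have [measurable]: "fst \<in> borel_measurable (lebesgue \<Otimes>\<^sub>M (lebesgue :: real measure))"
        "snd \<in> borel_measurable (lebesgue \<Otimes>\<^sub>M (lebesgue :: real measure))"
      using measurable_compose[OF measurable_fst, of "\<lambda>x. x" lebesgue borel lebesgue]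
        measurable_compose[OF measurable_snd, of "\<lambda>x. x" lebesgue borel lebesgue]
      by (simp_all add: measurable_completion)
    have "{z \<in> space (lebesgue \<Otimes>\<^sub>M lebesgue).
        min (fst z) (\<Psi> (fst z)) \<le> snd z \<and> snd z \<le> max (fst z) (\<Psi> (fst z))}
        \<in> sets (lebesgue \<Otimes>\<^sub>M lebesgue)"
      by measurable
    then show ?thesis by (simp add: A_def space_pair_measure)
  qed
  have A1: "emeasure lebesgue {x \<in> space lebesgue. (x, t) \<in> A} \<le> ennreal \<epsilon>" for t
  proof -
    obtain s where s: "t = \<Psi> s" using \<open>surj \<Psi>\<close> by auto
    \<comment> \<open>By monotonicity, \<open>\<Psi> s\<close> lies between \<open>x\<close> and \<open>\<Psi> x\<close> only if \<open>x\<close> lies between \<open>s\<close> and \<open>\<Psi> s\<close>.\<close>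
    have "{x \<in> space lebesgue. (x, t) \<in> A} \<subseteq> {min s t..max s t}"
      using strict_mono_less_eq[OF mono] by (auto simp: A_def s min_def max_def split: if_splits)
    then have "emeasure lebesgue {x \<in> space lebesgue. (x, t) \<in> A}
        \<le> emeasure lebesgue {min s t..max s t}"
      by (intro emeasure_mono) auto
    also have "\<dots> \<le> ennreal \<epsilon>"
      using disp[of s] by (auto simp: s intro!: ennreal_leI)
    finally show ?thesis .
  qed
  have A2: "emeasure lebesgue {t \<in> space lebesgue. (x, t) \<in> A} \<le> ennreal \<epsilon>" for x
    unfolding sec using disp[of x] by (auto intro!: ennreal_leI)
  have bound: "ennreal \<bar>primitive f x - primitive f (\<Psi> x)\<bar>
      \<le> (\<integral>\<^sup>+ t. ennreal \<bar>f t\<bar> * indicator {t \<in> space lebesgue. (x, t) \<in> A} t \<partial>lebesgue)" for x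
    unfolding sec by (rule abs_primitive_diff_le[OF f])
  show "Lp_norm p lebesgue (\<lambda>x. primitive f x - primitive f (\<Psi> x))
      \<le> ennreal \<epsilon> * Lp_norm p lebesgue f"
    by (rule Schur_test_indicator(1)[OF A _ meas \<open>\<epsilon> > 0\<close> p A1 A2 bound]) measurable
  show "Lp_norm p lebesgue (\<lambda>x. primitive f x - primitive f (\<Psi> x))
      \<le> ennreal (\<epsilon> powr enn2real (1 / p)) * Lp_norm 1 lebesgue f"
    by (rule Schur_test_indicator(2)[OF A _ meas \<open>\<epsilon> > 0\<close> p A1 A2 bound]) measurable
qed

section \<open>Deformations and their extension to the line\<close>

text \<open>
  An increasing map onto \<open>{c..d}\<close> sends endpoints to endpoints, so the translations that continue it
  move points by \<open>\<bar>c' - c\<bar>\<close> and \<open>\<bar>d' - d\<bar>\<close>, which are displacements of the given map. A constant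
  continuation would not keep the displacement bounded.
\<close>

lemma strict_mono_on_extend_by_translations:
  fixes \<Phi> :: "real \<Rightarrow> real"
  assumes "c' \<le> d'" and mono: "strict_mono_on {c'..d'} \<Phi>" and img: "\<Phi> ` {c'..d'} = {c..d}"
    and disp: "\<And>x. x \<in> {c'..d'} \<Longrightarrow> \<bar>x - \<Phi> x\<bar> \<le> \<epsilon>"
  obtains \<Psi> where "strict_mono \<Psi>" "surj \<Psi>" "\<And>x. \<bar>x - \<Psi> x\<bar> \<le> \<epsilon>"
    "\<And>x. x \<in> {c'..d'} \<Longrightarrow> \<Psi> x = \<Phi> x"
proof -
  have le: "\<Phi> x \<le> \<Phi> y" if "c' \<le> x" "x \<le> y" "y \<le> d'" for x y
    using that mono by (cases "x = y") (auto simp: strict_mono_on_def intro: less_imp_le)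
  have in_img: "c \<le> \<Phi> x" "\<Phi> x \<le> d" if "c' \<le> x" "x \<le> d'" for x
    using img that by auto
  have "c \<le> d" using in_img[of c'] \<open>c' \<le> d'\<close> by auto
  obtain x y where xy: "x \<in> {c'..d'}" "\<Phi> x = c" "y \<in> {c'..d'}" "\<Phi> y = d"
    using img \<open>c \<le> d\<close> by (metis atLeastAtMost_iff imageE order_refl)
  have ends: "\<Phi> c' = c" "\<Phi> d' = d"
    using xy le[of c' x] le[of y d'] in_img[of c'] in_img[of d'] \<open>c' \<le> d'\<close> by auto
  define \<Psi> where "\<Psi> x = (if x < c' then x + (c - c') else if x > d' then x + (d - d') else \<Phi> x)" for x
  have "strict_mono \<Psi>"
  proof (rule strict_monoI)
    fix x y :: real assume "x < y"
    then show "\<Psi> x < \<Psi> y"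
      using in_img[of x] in_img[of y] strict_mono_onD[OF mono, of x y] \<open>c \<le> d\<close> \<open>c' \<le> d'\<close>
      unfolding \<Psi>_def by (simp split: if_split) linarith
  qed
  moreover have "surj \<Psi>"
  proof (rule surjI)
    fix y
    show "\<Psi> (if y < c then y - (c - c') else if y > d then y - (d - d') else inv_into {c'..d'} \<Phi> y) = y"
      using f_inv_into_f[of y \<Phi> "{c'..d'}", unfolded img] \<open>c' \<le> d'\<close>
        inv_into_into[of y \<Phi> "{c'..d'}", unfolded img]
      unfolding \<Psi>_def by (auto simp: not_less)
  qed
  moreover have "\<bar>x - \<Psi> x\<bar> \<le> \<epsilon>" for x
    using disp[of x] disp[of c'] disp[of d'] ends \<open>c' \<le> d'\<close> by (auto simp: \<Psi>_def)
  moreover have "\<Psi> x = \<Phi> x" if "x \<in> {c'..d'}" for x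
    using that by (simp add: \<Psi>_def)
  ultimately show ?thesis by (rule that)
qed

text \<open>
  The substitution rule on \<open>J \<inter> {..x}\<close>, whose image under \<open>\<Phi>\<close> is \<open>I \<inter> {..\<Psi> x}\<close> because \<open>\<Psi>\<close> is
  increasing. Since \<open>f\<close> vanishes outside \<open>I\<close> and the deformed function outside \<open>J\<close>, this covers all
  points \<open>x\<close>, inside \<open>J\<close> or not.
\<close>

lemma primitive_deformed:
  fixes f \<Phi> \<Phi>' \<Psi> :: "real \<Rightarrow> real"
  assumes f: "integrable lebesgue f" and supp: "\<And>x. x \<notin> I \<Longrightarrow> f x = 0"
    and J: "J \<in> sets lebesgue" and I: "I \<in> sets lebesgue" and img: "\<Phi> ` J = I"
    and der: "\<And>x. x \<in> J \<Longrightarrow> (\<Phi> has_real_derivative \<Phi>' x) (at x within J)"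
    and pos: "\<And>x. x \<in> J \<Longrightarrow> \<Phi>' x > 0"
    and \<Psi>: "strict_mono \<Psi>" "\<And>x. x \<in> J \<Longrightarrow> \<Psi> x = \<Phi> x"
  shows "integrable lebesgue (deformed J \<Phi> \<Phi>' f)"
    and "primitive (deformed J \<Phi> \<Phi>' f) x = primitive f (\<Psi> x)"
proof -
  have inj: "inj_on \<Phi> J"
    using strict_mono_eq[OF \<Psi>(1)] \<Psi>(2) by (intro inj_onI) metis
  have f_on: "f absolutely_integrable_on T" if "T \<in> sets lebesgue" for T
    unfolding set_integrable_def by (intro integrable_mult_indicator f that)
  have change: "(\<lambda>x. \<bar>\<Phi>' x\<bar> * f (\<Phi> x)) absolutely_integrable_on S"
      "(LINT x:S|lebesgue. \<bar>\<Phi>' x\<bar> * f (\<Phi> x)) = (LINT x:\<Phi> ` S|lebesgue. f x)"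
    if S: "S \<subseteq> J" "S \<in> sets lebesgue" "\<Phi> ` S \<in> sets lebesgue" for S
  proof -
    have "(\<lambda>x. \<bar>\<Phi>' x\<bar> * f (\<Phi> x)) absolutely_integrable_on S \<and>
        integral S (\<lambda>x. \<bar>\<Phi>' x\<bar> * f (\<Phi> x)) = integral (\<Phi> ` S) f"
    proof (rule iffD2[OF has_absolute_integral_change_of_variables_1'
          [where S = S and g = \<Phi> and g' = \<Phi>' and f = f]])
      show "S \<in> sets lebesgue" by (rule S(2))
      show "inj_on \<Phi> S" by (rule inj_on_subset[OF inj S(1)])
      show "(\<Phi> has_real_derivative \<Phi>' x) (at x within S)" if "x \<in> S" for x
        using has_field_derivative_subset[OF der S(1)] that S(1) by blast
      show "f absolutely_integrable_on \<Phi> ` S \<and> integral (\<Phi> ` S) f = integral (\<Phi> ` S) f"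
        using f_on[OF S(3)] by simp
    qed
    then show "(\<lambda>x. \<bar>\<Phi>' x\<bar> * f (\<Phi> x)) absolutely_integrable_on S"
        "(LINT x:S|lebesgue. \<bar>\<Phi>' x\<bar> * f (\<Phi> x)) = (LINT x:\<Phi> ` S|lebesgue. f x)"
      using S f_on[of "\<Phi> ` S"] by (auto simp: set_lebesgue_integral_eq_integral(2))
  qed
  have "(\<lambda>x. indicator J x *\<^sub>R (\<bar>\<Phi>' x\<bar> * f (\<Phi> x))) = deformed J \<Phi> \<Phi>' f"
    using pos by (auto simp: deformed_def indicator_def fun_eq_iff abs_of_pos)
  then show "integrable lebesgue (deformed J \<Phi> \<Phi>' f)"
    using change(1)[of J] J I img by (simp add: set_integrable_def)
  have "\<Phi> ` (J \<inter> {..x}) = I \<inter> {..\<Psi> x}"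
  proof -
    have "\<Phi> t \<le> \<Psi> x \<longleftrightarrow> t \<le> x" if "t \<in> J" for t
      using \<Psi>(2)[OF that] strict_mono_less_eq[OF \<Psi>(1), of t x] by simp
    then show ?thesis unfolding img[symmetric] by blast
  qed
  moreover have "primitive (deformed J \<Phi> \<Phi>' f) x
      = (LINT t:J \<inter> {..x}|lebesgue. \<bar>\<Phi>' t\<bar> * f (\<Phi> t))"
    unfolding primitive_def set_lebesgue_integral_def using pos
    by (intro Bochner_Integration.integral_cong) (auto simp: deformed_def indicator_def abs_of_pos)
  moreover have "primitive f (\<Psi> x) = (LINT t:I \<inter> {..\<Psi> x}|lebesgue. f t)"
    unfolding primitive_def set_lebesgue_integral_def using supp
    by (intro Bochner_Integration.integral_cong) (auto simp: indicator_def)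
  ultimately show "primitive (deformed J \<Phi> \<Phi>' f) x = primitive f (\<Psi> x)"
    using change(2)[of "J \<inter> {..x}"] sets.Int[OF J, of "{..x}"] sets.Int[OF I, of "{..\<Psi> x}"] by simp
qed

lemma strict_mono_on_eps_deformation:
  assumes "eps_deformation \<epsilon> {c'..d'} I \<Phi> \<Phi>'" and pos: "\<And>x. x \<in> {c'..d'} \<Longrightarrow> \<Phi>' x > 0"
  shows "strict_mono_on {c'..d'} \<Phi>"
proof (rule strict_mono_onI)
  fix x y assume xy: "x \<in> {c'..d'}" "y \<in> {c'..d'}" "x < y"
  have der: "(\<Phi> has_real_derivative \<Phi>' z) (at z within {c'..d'})" if "z \<in> {c'..d'}" for z
    using assms(1) that by (auto simp: eps_deformation_def)
  show "\<Phi> x < \<Phi> y"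
  proof (rule DERIV_pos_imp_increasing_open[OF \<open>x < y\<close>])
    fix z assume "x < z" "z < y"
    then have "z \<in> interior {c'..d'}" "z \<in> {c'..d'}" using xy by auto
    then show "\<exists>l. (\<Phi> has_real_derivative l) (at z) \<and> 0 < l"
      using der[of z] pos[of z] at_within_interior[of z "{c'..d'}"] by metis
  next
    have "continuous_on {c'..d'} \<Phi>" by (rule DERIV_continuous_on) (rule der)
    then show "continuous_on {x..y} \<Phi>" by (rule continuous_on_subset) (use xy in auto)
  qed
qed

lemma volterra_eq_primitive:
  assumes "\<And>x. x < a \<Longrightarrow> h x = 0"
  shows "volterra a h x = primitive h x"
  unfolding volterra_def primitive_def set_lebesgue_integral_def using assms
  by (intro Bochner_Integration.integral_cong) (auto simp: indicator_def not_le)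

section \<open>The Volterra norm of the change under a deformation\<close>

theorem theorem4p3:
  fixes p :: ennreal and f \<Phi> \<Phi>' :: "real \<Rightarrow> real" and I J :: "real set"
    and c d c' d' a b \<epsilon> :: real
  assumes "1 \<le> p"
    and "c \<le> d" and "I = {c..d}"
    and "c' \<le> d'" and "J = {c'..d'}"
    and "in_Lp p lebesgue f"
    and "\<And>x. x \<notin> I \<Longrightarrow> f x = 0"
    and "\<epsilon> > 0"
    and "eps_deformation \<epsilon> J I \<Phi> \<Phi>'"
    and "\<And>x. x \<in> J \<Longrightarrow> \<Phi>' x > 0"
    and "I \<union> J \<subseteq> {a..b}"
  shows "volterra_norm p a b (\<lambda>x. f x - deformed J \<Phi> \<Phi>' f x)
    \<le> min (ennreal \<epsilon> * K_deform p J \<Phi> \<Phi>' f)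
          (ennreal (\<epsilon> powr enn2real (1 / p)) * Lp_norm 1 lebesgue f)"
proof -
  let ?g = "deformed J \<Phi> \<Phi>' f"
  have img: "\<Phi> ` J = I"
    and der: "\<And>x. x \<in> J \<Longrightarrow> (\<Phi> has_real_derivative \<Phi>' x) (at x within J)"
    and disp: "\<And>x. x \<in> J \<Longrightarrow> \<bar>x - \<Phi> x\<bar> \<le> \<epsilon>"
    using assms(9) by (auto simp: eps_deformation_def bij_betw_def)
  have f: "integrable lebesgue f"
    using assms(7) by (intro in_Lp_finite_support_integrable[OF assms(1,6), of I]) (auto simp: assms(2,3))
  have mono: "strict_mono_on {c'..d'} \<Phi>"
    using assms(9,10) unfolding assms(5) by (rule strict_mono_on_eps_deformation)
  obtain \<Psi> where \<Psi>: "strict_mono \<Psi>" "surj \<Psi>" "\<And>x. \<bar>x - \<Psi> x\<bar> \<le> \<epsilon>" "\<And>x. x \<in> {c'..d'} \<Longrightarrow> \<Psi> x = \<Phi> x"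
    using assms(4) mono img[unfolded assms(3,5)] disp unfolding assms(5)
    by (rule strict_mono_on_extend_by_translations) (assumption | rule that)+
  note \<Psi>_eq = \<Psi>(4)[folded assms(5)]
  have J: "J \<in> sets lebesgue" and I: "I \<in> sets lebesgue" by (simp_all add: assms(3,5))
  have deformed: "integrable lebesgue ?g" "\<And>x. primitive ?g x = primitive f (\<Psi> x)"
    by (rule primitive_deformed[OF f _ J I img _ _ \<Psi>(1)];
        (rule assms(7) der assms(10) \<Psi>_eq; assumption))+
  define h where "h x = primitive f x - primitive f (\<Psi> x)" for x
  note f_bounds = Lp_norm_primitive_displacement_le
    [OF f \<Psi>(1-3) \<open>\<epsilon> > 0\<close> \<open>1 \<le> p\<close>, folded h_def]

  \<comment> \<open>Since \<open>F = G \<circ> \<Psi>\<^sup>-\<^sup>1\<close>, the same estimate applies to \<open>G\<close> and the inverse displacement.\<close>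
  have \<Psi>_inv: "\<Psi> (inv \<Psi> x) = x" for x using \<Psi>(2) by (simp add: surj_f_inv_f)
  have inv_\<Psi>: "inv \<Psi> (\<Psi> x) = x" for x by (intro inv_f_f injI) (simp add: strict_mono_eq[OF \<Psi>(1)])
  have "Lp_norm p lebesgue (\<lambda>x. primitive ?g x - primitive ?g (inv \<Psi> x))
      \<le> ennreal \<epsilon> * Lp_norm p lebesgue ?g"
  proof (rule Lp_norm_primitive_displacement_le(2)[OF deformed(1) _ _ _ \<open>\<epsilon> > 0\<close> \<open>1 \<le> p\<close>])
    show "strict_mono (inv \<Psi>)" by (rule strict_mono_inv[OF \<Psi>(1,2) inv_\<Psi>])
    show "surj (inv \<Psi>)" by (rule surjI[of _ \<Psi>]) (rule inv_\<Psi>)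
    show "\<bar>x - inv \<Psi> x\<bar> \<le> \<epsilon>" for x
      using \<Psi>(3)[of "inv \<Psi> x"] by (simp add: \<Psi>_inv abs_minus_commute)
  qed
  also have "(\<lambda>x. primitive ?g x - primitive ?g (inv \<Psi> x))
      = (\<lambda>x. primitive f (\<Psi> x) - primitive f x)"
    by (simp add: deformed(2) \<Psi>_inv)
  finally have g_bound: "Lp_norm p lebesgue h \<le> ennreal \<epsilon> * Lp_norm p lebesgue ?g"
    unfolding h_def by (subst Lp_norm_minus_commute)

  have "volterra a (\<lambda>x. f x - ?g x) x = h x" for x
  proof -
    have "volterra a (\<lambda>x. f x - ?g x) x = primitive (\<lambda>x. f x - ?g x) x"
    proof (rule volterra_eq_primitive)
      fix x assume "x < a"
      then have "x \<notin> I \<and> x \<notin> J" using assms(11) by auto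
      then show "f x - ?g x = 0" using assms(7) by (simp add: deformed_def)
    qed
    also have "\<dots> = primitive f x - primitive ?g x"
      unfolding primitive_def using f deformed(1)
      by (intro set_integral_diff) (unfold set_integrable_def, (intro integrable_mult_indicator; simp)+)
    finally show ?thesis by (simp add: h_def deformed(2))
  qed
  then have "volterra a (\<lambda>x. f x - ?g x) = h" by blast
  then have "volterra_norm p a b (\<lambda>x. f x - ?g x) \<le> Lp_norm p lebesgue h"
    unfolding volterra_norm_def
    using Lp_norm_restrict_space_le[OF _ f_bounds(1) \<open>1 \<le> p\<close>, of "{a..b}"] by simp
  then show ?thesis
    using f_bounds(2,3) g_bound unfolding K_deform_def min_def by auto
qed

end
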